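(* Let $p$ be an odd prime. Let $a,b,c$ be tuples of Laurent polynomials in the variables $t=(t_1,\dots,t_r)$, $z=(z_1,\dots,z_{r'})$ with coefficients in $\mathbb{Z}_p$, where $a$ has length $l(a)\ge 1$ and $b$, $c$, $a'$ may be empty. Assume that the tuples $a*b$, $a*c$, $a'*b$, $a'*c$ are admissible. Then $$\mathrm{CT}_t\big(\widetilde{a*b}\big)(z)\;\mathrm{CT}_t\big(\widetilde{a'*c}\big)(z^p)\;\equiv\;\mathrm{CT}_t\big(\widetilde{a'*b}\big)(z^p)\;\mathrm{CT}_t\big(\widetilde{a*c}\big)(z)\pmod{p^{l(a)}},$$ as a congruence between Laurent polynomials in $z$ with coefficients in $\mathbb{Z}_p$.
   Context: For a tuple $a=(a_0,\dots,a_{l-1})$, $l(a)=l$ is its length, $a'=(a_1,\dots,a_{l-1})$ is the tuple of length $l-1$ obtained by deleting the first entry, and $a*b$ is the concatenation of tuples $a$ and $b$. For a tuple $\lambda=(\Lambda_0(t,z),\dots,\Lambda_{l-1}(t,z))$ of Laurent polynomials with coefficients in $\mathbb{Z}_p$, put $\tilde\lambda(t,z)=\widetilde{\lambda}(t,z)=\Lambda_0(t,z)\,\Lambda_1(t,z)^p\cdots\Lambda_{l-1}(t,z)^{p^{l-1}}$ (equal to $1$ for the empty tuple). $\mathrm{CT}_t(\Lambda)(z)$ denotes the constant term of the Laurent polynomial $\Lambda(t,z)$ with respect to the variables $t$; it is a Laurent polynomial in $z$. $z^p$ denotes $(z_1^p,\dots,z_{r'}^p)$. Admissibility: polytopes are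 convex hulls of finite subsets of $\mathbb{Z}^r\subset\mathbb{R}^r$, and sums are Minkowski sums. A tuple $(N_0,\dots,N_{l-1})$ of such polytopes is called admissible if for all $0\le i\le j\le l-1$, $$\big(N_i+pN_{i+1}+\dots+p^{j-i}N_j\big)\cap p^{j-i+1}\mathbb{Z}^r=\{0\}.$$ A tuple $(\Lambda_0,\dots,\Lambda_{l-1})$ of Laurent polynomials is admissible if the tuple $(N(\Lambda_0),\dots,N(\Lambda_{l-1}))$ is admissible, where $N(\Lambda)$ is the Newton polytope of $\Lambda(t,z)$ with respect to the variables $t$ only. The empty tuple is admissible. *)

theory Defs
  imports
    "HOL-Analysis.Analysis"
    "HOL-Library.Poly_Mapping"
    "HOL-Library.Set_Algebras"
    "HOL-Library.Cardinality"
    "HOL-Computational_Algebra.Primes"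
begin

section \<open>The ring of p-adic integers\<close>

text \<open>
  The inverse limit of the rings \<open>\<int>/p\<^sup>n\<int>\<close>, where \<open>p = CARD('p)\<close>; the \<open>n\<close>-th component is
  the representative in \<open>{0..<p\<^sup>n}\<close>. The range restriction is part of the compatibility
  condition, because the left-hand side of that equation is a remainder modulo \<open>p\<^sup>n\<close>.
  The ring structure makes sense for every base \<open>p \<ge> 2\<close> (class \<^class>\<open>card2\<close>), so primality of
  \<open>p\<close> is left to the theorems. Numeral types such as \<open>3\<close>, \<open>5\<close> belong to this class.
\<close>

typedef (overloaded) ('p::card2) padic_int =
  "{x :: nat \<Rightarrow> int. \<forall>n. x (Suc n) mod int CARD('p) ^ n = x n}"
  morphisms residue Abs_padic_int
  by (rule exI[of _ "\<lambda>_. 0"]) simp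

setup_lifting type_definition_padic_int

lemma mod_power_Suc_cancel: "(a mod q ^ Suc n) mod q ^ n = a mod (q ^ n :: int)"
  by (rule mod_mod_cancel) simp

lemma residue_mod [simp]:
  fixes x :: "'p::card2 padic_int"
  shows "residue x n mod int CARD('p) ^ n = residue x n"
proof -
  have "residue x (Suc n) mod int CARD('p) ^ n = residue x n"
    using residue[of x] by simp
  then show ?thesis by (metis mod_mod_trivial)
qed

instantiation padic_int :: (card2) comm_ring_1
begin

lift_definition zero_padic_int :: "'a padic_int" is "\<lambda>_. 0" by simp

lift_definition one_padic_int :: "'a padic_int" is "\<lambda>n. 1 mod int CARD('a) ^ n"
  by (simp only: mod_power_Suc_cancel)

lift_definition plus_padic_int :: "'a padic_int \<Rightarrow> 'a padic_int \<Rightarrow> 'a padic_int"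
  is "\<lambda>x y n. (x n + y n) mod int CARD('a) ^ n"
  by (metis mod_power_Suc_cancel mod_add_eq)

lift_definition uminus_padic_int :: "'a padic_int \<Rightarrow> 'a padic_int"
  is "\<lambda>x n. (- x n) mod int CARD('a) ^ n"
  by (metis mod_power_Suc_cancel mod_minus_eq)

lift_definition minus_padic_int :: "'a padic_int \<Rightarrow> 'a padic_int \<Rightarrow> 'a padic_int"
  is "\<lambda>x y n. (x n - y n) mod int CARD('a) ^ n"
  by (metis mod_power_Suc_cancel mod_diff_eq)

lift_definition times_padic_int :: "'a padic_int \<Rightarrow> 'a padic_int \<Rightarrow> 'a padic_int"
  is "\<lambda>x y n. (x n * y n) mod int CARD('a) ^ n"
  by (metis mod_power_Suc_cancel mod_mult_eq)

instance
proof
  fix a b c :: "'a padic_int"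
  note defs = residue_inject[symmetric] fun_eq_iff zero_padic_int.rep_eq one_padic_int.rep_eq
    plus_padic_int.rep_eq uminus_padic_int.rep_eq minus_padic_int.rep_eq times_padic_int.rep_eq
  show "a * b * c = a * (b * c)"
    by (simp add: defs mod_simps mult.assoc)
  show "a * b = b * a"
    by (simp add: defs mult.commute)
  show "1 * a = a"
    by (simp add: defs mod_simps)
  show "(a + b) * c = a * c + b * c"
    by (simp add: defs mod_simps distrib_right)
  show "a + b + c = a + (b + c)"
    by (simp add: defs mod_simps add.assoc)
  show "a + b = b + a"
    by (simp add: defs add.commute)
  show "0 + a = a"
    by (simp add: defs)
  show "- a + a = 0"
    by (simp add: defs mod_simps)
  show "a - b = a + - b"
    by (simp add: defs mod_simps)
  have "1 < int CARD('a)" by (rule one_less_int_card)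
  then have "residue (0 :: 'a padic_int) 1 \<noteq> residue 1 1"
    by (simp add: zero_padic_int.rep_eq one_padic_int.rep_eq)
  then show "(0 :: 'a padic_int) \<noteq> 1" by metis
qed

end

section \<open>Laurent polynomials\<close>

text \<open>
  A Laurent polynomial over \<open>\<int>\<^sub>p\<close> is a finitely supported function on the group of exponent
  vectors, with the convolution product of \<^theory>\<open>HOL-Library.Poly_Mapping\<close>. In
  \<open>laurent_tz\<close> a pair \<open>(u, v)\<close> is the exponent of \<open>t\<^sup>u z\<^sup>v\<close>, and \<open>r = CARD('r)\<close>, \<open>r' = CARD('s)\<close>.
\<close>

type_synonym ('r, 's, 'p) laurent_tz = "((int ^ 'r) \<times> (int ^ 's)) \<Rightarrow>\<^sub>0 'p padic_int"
type_synonym ('s, 'p) laurent_z = "(int ^ 's) \<Rightarrow>\<^sub>0 'p padic_int"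

text \<open>The constant term in \<open>t\<close>; on \<open>laurent_tz\<close> its values are of type \<open>laurent_z\<close>.\<close>

lift_definition CT :: "('u::zero \<times> 'v \<Rightarrow>\<^sub>0 'b::zero) \<Rightarrow> ('v \<Rightarrow>\<^sub>0 'b)"
  is "\<lambda>f v. f (0, v)"
  by (auto dest!: finite_vimageI[where h = "Pair 0"] simp: inj_on_def vimage_def)

text \<open>The substitution \<open>f(z) \<mapsto> f(z\<^sup>p)\<close>, that is \<open>z\<^sub>i \<mapsto> z\<^sub>i\<^sup>p\<close> for all \<open>i\<close>.\<close>

definition subst_power :: "nat \<Rightarrow> ('s::finite, 'p::card2) laurent_z \<Rightarrow> ('s, 'p) laurent_z" where
  "subst_power p f =
     (\<Sum>v\<in>Poly_Mapping.keys f. Poly_Mapping.single (\<chi> i. int p * v $ i) (Poly_Mapping.lookup f v))"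

definition twisted_prod ::
  "nat \<Rightarrow> ('r::finite, 's::finite, 'p::card2) laurent_tz list \<Rightarrow> ('r, 's, 'p) laurent_tz" where
  "twisted_prod p L = (\<Prod>i<length L. (L ! i) ^ (p ^ i))"

section \<open>Newton polytopes and admissibility\<close>

definition real_vec :: "int ^ 'r \<Rightarrow> real ^ 'r::finite" where
  "real_vec u = (\<chi> i. real_of_int (u $ i))"

text \<open>Only the exponents of \<open>t\<close> enter; note that the polytope of \<open>0\<close> is empty.\<close>

definition newton_polytope ::
  "('r::finite, 's::finite, 'p::card2) laurent_tz \<Rightarrow> (real ^ 'r) set" where
  "newton_polytope f = convex hull (real_vec ` fst ` Poly_Mapping.keys f)"

text \<open>The sum below is the Minkowski sum of \<^theory>\<open>HOL-Library.Set_Algebras\<close>.\<close>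

definition admissible_polytopes :: "nat \<Rightarrow> (real ^ 'r::finite) set list \<Rightarrow> bool" where
  "admissible_polytopes p N \<longleftrightarrow>
     (\<forall>i j. i \<le> j \<and> j < length N \<longrightarrow>
        (\<Sum>k=i..j. (\<lambda>x. real p ^ (k - i) *\<^sub>R x) ` (N ! k))
          \<inter> range (\<lambda>u. real p ^ (j - i + 1) *\<^sub>R real_vec u) = {0})"

definition admissible ::
  "nat \<Rightarrow> ('r::finite, 's::finite, 'p::card2) laurent_tz list \<Rightarrow> bool" where
  "admissible p L \<longleftrightarrow> admissible_polytopes p (map newton_polytope L)"

end

theory Submission
  imports Defs
begin

text \<open>Let \<open>\<sigma>\<close> be the substitution \<open>t \<mapsto> t\<^sup>p, z \<mapsto> z\<^sup>p\<close>. Every Laurent polynomial satisfies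
  \<open>f\<^sup>p \<equiv> \<sigma> f\<close> modulo \<open>p\<close>, hence powers of \<open>f\<close> with exponent \<open>p\<^sup>n\<close> are known to high p-adic precision
  from those with exponent \<open>p\<^sup>n\<^sup>-\<^sup>1\<close>. So the twisted product of a tuple almost splits at each place
  \<open>k\<close> as the twisted product of the first \<open>k\<close> entries times \<open>\<sigma>\<^sup>k\<close> of that of the remaining ones.

  To make this exact, the twisted product of a tuple \<open>\<lambda>\<close> is written as \<open>\<Sum> I\<^sub>k \<sigma>\<^sup>k(R\<^sub>k)\<close> over
  \<open>1 \<le> k \<le> l(\<lambda>)\<close>. Here \<open>R\<^sub>k\<close> is the twisted product of the entries from \<open>k\<close> on, and the
  \<^emph>\<open>indecomposable part\<close> \<open>I\<^sub>k\<close> depends on the first \<open>k\<close> entries only. Two facts matter. First, \<open>I\<^sub>k\<close> is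
  divisible by \<open>p\<^sup>k\<^sup>-\<^sup>1\<close> (\<open>dvd_indecomposable_part\<close>): each of the \<open>k - 1\<close> inner places at which it does
  not split contributes a factor \<open>p\<close>. Second, the exponents of \<open>I\<^sub>k\<close> lie in \<open>N\<^sub>0 + \<dots> + p\<^sup>k\<^sup>-\<^sup>1 N\<^sub>k\<^sub>-\<^sub>1\<close>, so by
  admissibility the constant term of \<open>I\<^sub>k \<sigma>\<^sup>k(R\<^sub>k)\<close> is the product of the constant terms
  (\<open>CT_indecomposable_part_mult_frob\<close>).

  Put \<open>n = l(a)\<close> and let \<open>X\<^sub>i\<close> be the constant term of the twisted product of \<open>a * b\<close> without its
  first \<open>i\<close> entries, evaluated at \<open>z\<close> to the power \<open>p\<^sup>i\<close>; let \<open>Y\<^sub>i\<close> be the same for \<open>a * c\<close>. The decomposition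
  says that \<open>X\<close> and \<open>Y\<close> solve, up to errors divisible by \<open>p\<^sup>n\<^sup>-\<^sup>i\<close>, the same triangular system
  \<open>X\<^sub>i = \<Sum> J\<^sub>i\<^sub>k X\<^sub>k\<close> over \<open>i < k \<le> n\<close>, where \<open>J\<^sub>i\<^sub>k\<close> depends on \<open>a\<close> only and is divisible by
  \<open>p\<^sup>k\<^sup>-\<^sup>i\<^sup>-\<^sup>1\<close>. It follows (\<open>dvd_triangular_determinant\<close>) that \<open>X\<^sub>i Y\<^sub>j - X\<^sub>j Y\<^sub>i\<close> is divisible by
  \<open>p\<^sup>n\<^sup>-\<^sup>j\<^sup>+\<^sup>1\<close> for \<open>i < j \<le> n\<close>. The case \<open>i = 0\<close>, \<open>j = 1\<close> is the congruence sought.\<close>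

section \<open>Congruences of powers in commutative rings\<close>

lemma prime_dvd_freshman_power:
  fixes x y :: "'a::comm_ring_1"
  assumes "prime p"
  shows "of_nat p dvd (x + y) ^ p - (x ^ p + y ^ p)"
proof -
  have "0 < p" using assms prime_gt_0_nat by blast
  define f where "f k = of_nat (p choose k) * x ^ k * y ^ (p - k)" for k
  have "{..p} = insert 0 (insert p {0<..<p})" using \<open>0 < p\<close> by auto
  then have "(x + y) ^ p = f 0 + (f p + sum f {0<..<p})"
    using \<open>0 < p\<close> by (simp add: binomial_ring f_def)
  also have "\<dots> = x ^ p + y ^ p + sum f {0<..<p}"
    by (simp add: f_def)
  finally have "(x + y) ^ p - (x ^ p + y ^ p) = sum f {0<..<p}" by simp
  moreover have "of_nat p dvd sum f {0<..<p}"
  proof (rule dvd_sum)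
    fix k assume "k \<in> {0<..<p}"
    then have "p dvd p choose k" using assms by (intro dvd_choose_prime) auto
    then have "(of_nat p :: 'a) dvd of_nat (p choose k)" by (auto simp: dvd_def)
    then show "of_nat p dvd f k" by (simp add: f_def)
  qed
  ultimately show ?thesis by simp
qed

lemma prime_dvd_sum_power_diff:
  fixes f :: "'i \<Rightarrow> 'a::comm_ring_1"
  assumes "prime p" "finite A"
  shows "of_nat p dvd (\<Sum>i\<in>A. f i) ^ p - (\<Sum>i\<in>A. f i ^ p)"
  using assms(2)
proof (induction A)
  case empty
  then show ?case using assms(1) by (simp add: power_0_left prime_gt_0_nat)
next
  case (insert i A)
  have eq: "(f i + sum f A) ^ p - (f i ^ p + (\<Sum>j\<in>A. f j ^ p)) =
    ((f i + sum f A) ^ p - (f i ^ p + sum f A ^ p)) + (sum f A ^ p - (\<Sum>j\<in>A. f j ^ p))"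
    by simp
  show ?case
    unfolding sum.insert[OF insert.hyps] eq
    by (intro dvd_add prime_dvd_freshman_power assms(1) insert.IH)
qed

text \<open>Fermat's little theorem, obtained by expanding the \<open>p\<close>-th power of a sum of \<open>n\<close> ones.\<close>

lemma prime_dvd_of_nat_power_diff:
  assumes "prime p"
  shows "(of_nat p :: 'a::comm_ring_1) dvd of_nat n ^ p - of_nat n"
  using prime_dvd_sum_power_diff[OF assms, of "{..<n}" "\<lambda>_. 1 :: 'a"] by simp

text \<open>In \<open>x\<^sup>p - y\<^sup>p = (x - y) (\<Sum> y\<^sup>p\<^sup>-\<^sup>1\<^sup>-\<^sup>i x\<^sup>i)\<close> the second factor is congruent to
  \<open>p y\<^sup>p\<^sup>-\<^sup>1\<close> modulo \<open>x - y\<close>, so it supplies one more factor \<open>p\<close>.\<close>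

lemma dvd_power_diff_lift:
  fixes x y :: "'a::comm_ring_1"
  assumes "of_nat p ^ Suc m dvd x - y"
  shows "of_nat p ^ Suc (Suc m) dvd x ^ p - y ^ p"
proof (cases p)
  case (Suc n)
  have xy: "of_nat p dvd x - y" using assms by (auto intro: dvd_mult_left)
  have pw: "of_nat p dvd x ^ i - y ^ i" for i
    unfolding power_diff_sumr2 using xy by (rule dvd_mult2)
  have "(\<Sum>i<p. y ^ (p - Suc i) * x ^ i) =
      (\<Sum>i<p. y ^ (p - Suc i) * (x ^ i - y ^ i)) + of_nat p * y ^ n"
    by (simp add: right_diff_distrib sum_subtractf power_add[symmetric] Suc)
  then have "of_nat p dvd (\<Sum>i<p. y ^ (p - Suc i) * x ^ i)"
    by (simp add: pw dvd_sum)
  then have "of_nat p ^ Suc m * of_nat p dvd (x - y) * (\<Sum>i<p. y ^ (p - Suc i) * x ^ i)"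
    using assms by (intro mult_dvd_mono)
  then show ?thesis by (simp add: power_diff_sumr2 mult.commute mult.left_commute)
qed (use assms in auto)

lemma dvd_iterated_power_diff:
  fixes x y :: "'a::comm_ring_1"
  assumes "of_nat p dvd x ^ p - y"
  shows "of_nat p ^ Suc m dvd x ^ (p ^ Suc m) - y ^ (p ^ m)"
proof (induction m)
  case 0
  then show ?case using assms by simp
next
  case (Suc m)
  show ?case
    using dvd_power_diff_lift[OF Suc.IH] by (simp add: power_mult[symmetric] mult.commute mult.left_commute)
qed

section \<open>Fermat's little theorem in the p-adic integers\<close>

lemma residue_of_nat: "residue (of_nat m :: 'p::card2 padic_int) n = int m mod int CARD('p) ^ n"
  by (induction m) (simp_all add: zero_padic_int.rep_eq one_padic_int.rep_eq
      plus_padic_int.rep_eq mod_simps)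

lemma residue_mod_power:
  fixes x :: "'p::card2 padic_int"
  assumes "m \<le> n"
  shows "residue x n mod int CARD('p) ^ m = residue x m"
  using assms
proof (induction n rule: dec_induct)
  case base
  then show ?case by simp
next
  case (step n)
  have "residue x (Suc n) mod int CARD('p) ^ m =
      residue x (Suc n) mod int CARD('p) ^ n mod int CARD('p) ^ m"
    using step(1) by (simp add: mod_mod_cancel le_imp_power_dvd)
  also have "residue x (Suc n) mod int CARD('p) ^ n = residue x n"
    using residue[of x] by simp
  finally show ?case using step by simp
qed

text \<open>The witness is the shifted sequence of quotients \<open>residue x (n + 1) div p\<close>: dividing by \<open>p\<close>
  costs one digit of precision.\<close>

lemma dvd_padic_int_if_residue_zero:
  fixes x :: "'p::card2 padic_int"
  assumes "residue x 1 = 0"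
  shows "of_nat CARD('p) dvd x"
proof -
  define q where "q = int CARD('p)"
  have q: "q > 0" by (simp add: q_def)
  define y :: "'p padic_int" where "y = Abs_padic_int (\<lambda>n. residue x (Suc n) div q)"
  have "residue x (Suc (Suc n)) div q mod q ^ n = residue x (Suc n) div q" for n
  proof -
    have "residue x (Suc n) = residue x (Suc (Suc n)) mod (q * q ^ n)"
      using residue_mod_power[of "Suc n" "Suc (Suc n)" x] by (simp add: q_def)
    also have "\<dots> = q * (residue x (Suc (Suc n)) div q mod q ^ n) + residue x (Suc (Suc n)) mod q"
      using q by (intro zmod_zmult2_eq) simp
    also have "residue x (Suc (Suc n)) mod q = 0"
      using residue_mod_power[of 1 "Suc (Suc n)" x] assms by (simp add: q_def)
    finally show ?thesis using q by simp
  qed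
  then have y: "residue y = (\<lambda>n. residue x (Suc n) div q)"
    unfolding y_def by (subst Abs_padic_int_inverse) (simp_all add: q_def)
  have "residue (of_nat CARD('p) * y) n = residue x n" for n
  proof -
    have "residue (of_nat CARD('p) * y) n = q * (residue x (Suc n) div q) mod q ^ n"
      by (simp add: times_padic_int.rep_eq residue_of_nat y q_def mod_simps)
    also have "q * (residue x (Suc n) div q) = residue x (Suc n)"
      using residue_mod_power[of 1 "Suc n" x] assms by (simp add: q_def mod_0_imp_dvd)
    also have "\<dots> mod q ^ n = residue x n"
      using residue_mod_power[of n "Suc n" x] by (simp add: q_def)
    finally show ?thesis .
  qed
  then have "of_nat CARD('p) * y = x" by (metis ext residue_inject)
  then show ?thesis by (metis dvd_triv_left)
qed

text \<open>Modulo \<open>p\<close> the ring of p-adic integers is the prime field, whose elements are fixed by the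
  \<open>p\<close>-th power map. For this reason the Frobenius lift below can leave the coefficients alone.\<close>

lemma fermat_padic_int:
  fixes x :: "'p::card2 padic_int"
  assumes "prime CARD('p)"
  shows "of_nat CARD('p) dvd x ^ CARD('p) - x"
proof -
  define m :: "'p padic_int" where "m = of_nat (nat (residue x 1))"
  have "residue x 1 \<ge> 0"
    using residue_mod[of x 1] pos_mod_sign[of "int CARD('p)" "residue x 1"] by simp
  then have "residue (x - m) 1 = 0"
    by (simp add: m_def minus_padic_int.rep_eq residue_of_nat mod_simps del: of_nat_nat)
  then have xm: "of_nat CARD('p) dvd x - m" by (rule dvd_padic_int_if_residue_zero)
  then have "of_nat CARD('p) dvd x ^ CARD('p) - m ^ CARD('p)"
    unfolding power_diff_sumr2 by (rule dvd_mult2)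
  moreover have "of_nat CARD('p) dvd m ^ CARD('p) - m"
    unfolding m_def by (rule prime_dvd_of_nat_power_diff[OF assms])
  moreover have "x ^ CARD('p) - x = (x ^ CARD('p) - m ^ CARD('p)) + (m ^ CARD('p) - m) - (x - m)"
    by simp
  ultimately show ?thesis using xm by (simp only: dvd_add dvd_diff)
qed

section \<open>Substitutions on exponents and the constant term\<close>

text \<open>The push-forward of coefficients along a map of exponents: a monomial with exponent \<open>k\<close> becomes
  one with exponent \<open>h k\<close>. For an additive \<open>h\<close> this is a ring homomorphism; both
  \<^const>\<open>subst_power\<close> and its analogue in the variables \<open>t\<close> and \<open>z\<close> together are instances.\<close>

definition map_exponents :: "('a \<Rightarrow> 'b) \<Rightarrow> ('a \<Rightarrow>\<^sub>0 'c::comm_monoid_add) \<Rightarrow> ('b \<Rightarrow>\<^sub>0 'c)" where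
  "map_exponents h f = (\<Sum>k\<in>Poly_Mapping.keys f. Poly_Mapping.single (h k) (Poly_Mapping.lookup f k))"

lemma sum_single_lookup: "(\<Sum>k\<in>Poly_Mapping.keys f. Poly_Mapping.single k (Poly_Mapping.lookup f k)) = f"
  by (rule poly_mapping_eqI)
    (auto simp: lookup_sum lookup_single when_def sum.If_cases in_keys_iff if_distrib sum.delta
      cong: if_cong)

lemma map_exponents_superset:
  assumes "finite S" "Poly_Mapping.keys f \<subseteq> S"
  shows "map_exponents h f = (\<Sum>k\<in>S. Poly_Mapping.single (h k) (Poly_Mapping.lookup f k))"
  unfolding map_exponents_def using assms by (intro sum.mono_neutral_left) (auto simp: in_keys_iff)

lemma map_exponents_0 [simp]: "map_exponents h 0 = 0"
  by (simp add: map_exponents_def)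

lemma map_exponents_single [simp]:
  "map_exponents h (Poly_Mapping.single k c) = Poly_Mapping.single (h k) c"
  by (subst map_exponents_superset[of "{k}"]) auto

lemma map_exponents_add: "map_exponents h (f + g) = map_exponents h f + map_exponents h g"
proof -
  define S where "S = Poly_Mapping.keys f \<union> Poly_Mapping.keys g"
  have "finite S" "Poly_Mapping.keys (f + g) \<subseteq> S" "Poly_Mapping.keys f \<subseteq> S" "Poly_Mapping.keys g \<subseteq> S"
    using keys_add[of f g] by (auto simp: S_def)
  then show ?thesis
    by (simp add: map_exponents_superset[of S] lookup_add single_add sum.distrib)
qed

lemma map_exponents_sum: "map_exponents h (\<Sum>i\<in>A. f i) = (\<Sum>i\<in>A. map_exponents h (f i))"
  by (induction A rule: infinite_finite_induct) (simp_all add: map_exponents_add)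

lemma map_exponents_diff:
  fixes f g :: "'a \<Rightarrow>\<^sub>0 'c::ab_group_add"
  shows "map_exponents h (f - g) = map_exponents h f - map_exponents h g"
  using map_exponents_add[of h "f - g" g] by simp

lemma map_exponents_comp: "map_exponents h (map_exponents h' f) = map_exponents (h \<circ> h') f"
  unfolding map_exponents_def[of h'] map_exponents_sum
  by (simp add: map_exponents_def[of "h \<circ> h'"])

lemma map_exponents_id: "map_exponents id f = f"
  by (simp add: map_exponents_def sum_single_lookup)

lemma map_exponents_mult:
  fixes f g :: "'a::monoid_add \<Rightarrow>\<^sub>0 'c::comm_semiring_0"
  assumes "\<And>a b. h (a + b) = h a + h b"
  shows "map_exponents h (f * g) = map_exponents h f * map_exponents h g"
proof -
  have "f * g = (\<Sum>a\<in>Poly_Mapping.keys f. Poly_Mapping.single a (Poly_Mapping.lookup f a)) *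
      (\<Sum>b\<in>Poly_Mapping.keys g. Poly_Mapping.single b (Poly_Mapping.lookup g b))"
    by (simp add: sum_single_lookup)
  then show ?thesis
    by (simp add: sum_product mult_single map_exponents_sum assms)
      (simp add: map_exponents_def sum_product mult_single)
qed

lemma map_exponents_power:
  fixes f :: "'a::comm_monoid_add \<Rightarrow>\<^sub>0 'c::comm_semiring_1"
  assumes "\<And>a b. h (a + b) = h a + h b" "h 0 = 0"
  shows "map_exponents h (f ^ n) = map_exponents h f ^ n"
  using assms by (induction n) (simp_all add: map_exponents_mult flip: single_one)

lemma map_exponents_prod:
  fixes f :: "'i \<Rightarrow> 'a::comm_monoid_add \<Rightarrow>\<^sub>0 'c::comm_semiring_1"
  assumes "\<And>a b. h (a + b) = h a + h b" "h 0 = 0"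
  shows "map_exponents h (\<Prod>i\<in>A. f i) = (\<Prod>i\<in>A. map_exponents h (f i))"
  using assms
  by (induction A rule: infinite_finite_induct) (simp_all add: map_exponents_mult flip: single_one)

text \<open>Additive maps are linear over the integers, so congruences modulo an integer pass through all the
  maps used below: the substitutions, the constant term, and the formation of monomials.\<close>

lemma dvd_additive_image:
  fixes F :: "'a::comm_ring_1 \<Rightarrow> 'b::comm_ring_1"
  assumes "\<And>x y. F (x + y) = F x + F y" "of_nat n dvd x"
  shows "of_nat n dvd F x"
proof -
  from assms(2) obtain y where y: "x = of_nat n * y" by auto
  have "F 0 = 0" using assms(1)[of 0 0] by simp
  then have "F (of_nat m * y) = of_nat m * F y" for m
    by (induction m) (simp_all add: assms(1) distrib_right)
  then show ?thesis using y by simp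
qed

lemma lookup_CT: "Poly_Mapping.lookup (CT f) v = Poly_Mapping.lookup f (0, v)"
  by transfer simp

lemma CT_add: "CT (f + g) = CT f + CT g"
  by (rule poly_mapping_eqI) (simp add: lookup_CT lookup_add)

lemma CT_0 [simp]: "CT 0 = 0"
  by (rule poly_mapping_eqI) (simp add: lookup_CT)

lemma CT_sum: "CT (\<Sum>i\<in>A. f i) = (\<Sum>i\<in>A. CT (f i))"
  by (induction A rule: infinite_finite_induct) (simp_all add: CT_add)

lemma CT_single:
  "CT (Poly_Mapping.single k c) = (if fst k = 0 then Poly_Mapping.single (snd k) c else 0)"
proof (rule poly_mapping_eqI)
  fix v
  show "Poly_Mapping.lookup (CT (Poly_Mapping.single k c)) v =
      Poly_Mapping.lookup (if fst k = 0 then Poly_Mapping.single (snd k) c else 0) v"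
    by (cases k) (simp add: lookup_CT lookup_single when_def)
qed

text \<open>The hypothesis on the exponents says that a monomial of \<open>f\<close> times a transformed monomial is
  constant in the first variables only if both factors are; so the constant term sees no mixed
  products.\<close>

lemma CT_mult_map_exponents:
  fixes f g :: "'a::comm_monoid_add \<times> 'b::comm_monoid_add \<Rightarrow>\<^sub>0 'c::comm_semiring_0"
  assumes "\<And>x y. x \<in> Poly_Mapping.keys f \<Longrightarrow> fst x + h y = 0 \<Longrightarrow> fst x = 0 \<and> y = 0" and "h 0 = 0"
  shows "CT (f * map_exponents (map_prod h h') g) = CT f * map_exponents h' (CT g)"
proof -
  let ?f = "\<lambda>x. Poly_Mapping.single x (Poly_Mapping.lookup f x)"
  let ?g = "\<lambda>y. Poly_Mapping.single y (Poly_Mapping.lookup g y)"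
  have "CT (?f x * map_exponents (map_prod h h') (?g y)) =
      CT (?f x) * map_exponents h' (CT (?g y))" if "x \<in> Poly_Mapping.keys f" for x y
    using assms(1)[OF that, of "fst y"] assms(2)
    by (auto simp: mult_single CT_single)
  then have "(\<Sum>x\<in>Poly_Mapping.keys f. \<Sum>y\<in>Poly_Mapping.keys g.
        CT (?f x * map_exponents (map_prod h h') (?g y))) =
      (\<Sum>x\<in>Poly_Mapping.keys f. \<Sum>y\<in>Poly_Mapping.keys g. CT (?f x) * map_exponents h' (CT (?g y)))"
    by simp
  then have "CT ((\<Sum>x\<in>Poly_Mapping.keys f. ?f x) *
        map_exponents (map_prod h h') (\<Sum>y\<in>Poly_Mapping.keys g. ?g y)) =
      CT (\<Sum>x\<in>Poly_Mapping.keys f. ?f x) * map_exponents h' (CT (\<Sum>y\<in>Poly_Mapping.keys g. ?g y))"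
    by (simp only: map_exponents_sum CT_sum sum_product)
  then show ?thesis by (simp only: sum_single_lookup)
qed

section \<open>The Frobenius substitution\<close>

definition scale_exponent :: "nat \<Rightarrow> int ^ 'r \<Rightarrow> int ^ 'r::finite" where
  "scale_exponent n u = (\<chi> i. int n * u $ i)"

lemma scale_exponent_nth [simp]: "scale_exponent n u $ i = int n * u $ i"
  by (simp add: scale_exponent_def)

lemma scale_exponent_add: "scale_exponent n (u + v) = scale_exponent n u + scale_exponent n v"
  by (simp add: vec_eq_iff distrib_left)

lemma scale_exponent_zero [simp]: "scale_exponent n 0 = 0"
  by (simp add: vec_eq_iff)

lemma scale_exponent_comp: "scale_exponent m \<circ> scale_exponent n = scale_exponent (m * n)"
  by (simp add: fun_eq_iff vec_eq_iff)

lemma scale_exponent_1: "scale_exponent 1 = id"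
  by (simp add: fun_eq_iff vec_eq_iff)

lemma subst_power_eq_map_exponents: "subst_power n = map_exponents (scale_exponent n)"
  by (simp add: fun_eq_iff subst_power_def map_exponents_def scale_exponent_def)

lemma subst_power_add: "subst_power n (f + g) = subst_power n f + subst_power n g"
  by (simp add: subst_power_eq_map_exponents map_exponents_add)

lemma subst_power_mult: "subst_power n (f * g) = subst_power n f * subst_power n g"
  by (simp add: subst_power_eq_map_exponents map_exponents_mult scale_exponent_add)

lemma subst_power_sum: "subst_power n (\<Sum>i\<in>A. f i) = (\<Sum>i\<in>A. subst_power n (f i))"
  by (simp add: subst_power_eq_map_exponents map_exponents_sum)

lemma subst_power_subst_power: "subst_power m (subst_power n f) = subst_power (m * n) f"
  by (simp add: subst_power_eq_map_exponents map_exponents_comp scale_exponent_comp)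

lemma subst_power_1: "subst_power 1 f = f"
  by (simp only: subst_power_eq_map_exponents scale_exponent_1 map_exponents_id)

text \<open>The substitution \<open>f(t, z) \<mapsto> f(t\<^sup>n, z\<^sup>n)\<close>. For \<open>n = p\<close> it lifts the Frobenius endomorphism of
  Laurent polynomials modulo \<open>p\<close>.\<close>

definition frob ::
  "nat \<Rightarrow> ('r::finite, 's::finite, 'p::card2) laurent_tz \<Rightarrow> ('r, 's, 'p) laurent_tz" where
  "frob n = map_exponents (map_prod (scale_exponent n) (scale_exponent n))"

lemma scale_pair_add:
  "map_prod (scale_exponent n) (scale_exponent n) (x + y) =
     map_prod (scale_exponent n) (scale_exponent n) x + map_prod (scale_exponent n) (scale_exponent n) y"
  by (cases x; cases y) (simp add: scale_exponent_add)

lemma scale_pair_zero: "map_prod (scale_exponent n) (scale_exponent n) 0 = 0"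
  by (simp add: zero_prod_def)

lemmas scale_pair_hom = scale_pair_add scale_pair_zero

lemma frob_mult: "frob n (f * g) = frob n f * frob n g"
  by (simp add: frob_def map_exponents_mult scale_pair_hom)

lemma frob_power: "frob n (f ^ m) = frob n f ^ m"
  by (simp add: frob_def map_exponents_power scale_pair_hom)

lemma frob_prod: "frob n (\<Prod>i\<in>A. f i) = (\<Prod>i\<in>A. frob n (f i))"
  by (simp add: frob_def map_exponents_prod scale_pair_hom)

lemma frob_add: "frob n (f + g) = frob n f + frob n g"
  by (simp add: frob_def map_exponents_add)

lemma frob_diff: "frob n (f - g) = frob n f - frob n g"
  by (simp add: frob_def map_exponents_diff)

lemma frob_frob: "frob m (frob n f) = frob (m * n) f"
  by (simp add: frob_def map_exponents_comp map_prod.comp scale_exponent_comp)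

lemma frob_1: "frob 1 f = f"
  by (simp only: frob_def scale_exponent_1 map_prod.id map_exponents_id)

text \<open>Modulo \<open>p\<close> the \<open>p\<close>-th power map is additive, and it sends a monomial \<open>c t\<^sup>u z\<^sup>v\<close> to
  \<open>c\<^sup>p t\<^sup>p\<^sup>u z\<^sup>p\<^sup>v\<close>, where \<open>c\<^sup>p\<close> is congruent to \<open>c\<close>.\<close>

lemma frob_congruence:
  fixes f :: "('r::finite, 's::finite, 'p::card2) laurent_tz"
  assumes p: "CARD('p) = p" "prime p"
  shows "of_nat p dvd f ^ p - frob p f"
proof -
  let ?c = "Poly_Mapping.lookup f"
  let ?h = "map_prod (scale_exponent p) (scale_exponent p) :: (int^'r) \<times> (int^'s) \<Rightarrow> _"
  have sp: "Poly_Mapping.single k c ^ n =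
      Poly_Mapping.single (map_prod (scale_exponent n) (scale_exponent n) k) (c ^ n)"
    for k :: "(int^'r) \<times> (int^'s)" and c :: "'p padic_int" and n
  proof (induction n)
    case 0
    have "map_prod (scale_exponent 0) (scale_exponent 0) k = 0"
      by (cases k) (simp add: zero_prod_def vec_eq_iff)
    then show ?case by simp
  next
    case (Suc n)
    have "k + map_prod (scale_exponent n) (scale_exponent n) k =
        map_prod (scale_exponent (Suc n)) (scale_exponent (Suc n)) k"
      by (cases k) (simp add: vec_eq_iff distrib_right)
    then show ?case by (simp add: Suc mult_single)
  qed
  have "of_nat p dvd (\<Sum>k\<in>Poly_Mapping.keys f. Poly_Mapping.single k (?c k)) ^ p -
      (\<Sum>k\<in>Poly_Mapping.keys f. Poly_Mapping.single k (?c k) ^ p)"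
    by (intro prime_dvd_sum_power_diff p(2)) simp
  then have 1: "of_nat p dvd f ^ p - (\<Sum>k\<in>Poly_Mapping.keys f. Poly_Mapping.single k (?c k) ^ p)"
    by (simp only: sum_single_lookup)
  have "of_nat p dvd Poly_Mapping.single k (?c k) ^ p - Poly_Mapping.single (?h k) (?c k)" for k
  proof -
    have "of_nat p dvd ?c k ^ p - ?c k"
      using fermat_padic_int[where 'p = 'p, of "?c k"] p by simp
    then have "of_nat p dvd Poly_Mapping.single (?h k) (?c k ^ p - ?c k)"
      by (intro dvd_additive_image[where F = "Poly_Mapping.single (?h k)"] single_add)
    then show ?thesis by (simp only: sp single_diff)
  qed
  then have "of_nat p dvd (\<Sum>k\<in>Poly_Mapping.keys f. Poly_Mapping.single k (?c k) ^ p - Poly_Mapping.single (?h k) (?c k))"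
    by (intro dvd_sum)
  then have 2: "of_nat p dvd (\<Sum>k\<in>Poly_Mapping.keys f. Poly_Mapping.single k (?c k) ^ p) - frob p f"
    by (simp only: sum_subtractf frob_def map_exponents_def)
  show ?thesis using dvd_add[OF 1 2] by simp
qed

text \<open>Write \<open>\<sigma>\<close> for \<^term>\<open>frob p\<close>. Raising \<open>f\<^sup>p \<equiv> \<sigma> f\<close> to the power \<open>p\<^sup>n\<close> gives a congruence modulo
  \<open>p\<^sup>n\<^sup>+\<^sup>1\<close>, the modulus being the total power to which \<open>f\<close> is raised. Replacing \<open>p\<close>-th powers by \<open>\<sigma>\<close> one at a
  time lowers that power, so the last of the \<open>k\<close> replacements determines the precision.\<close>

lemma frob_power_congruence:
  fixes f :: "('r::finite, 's::finite, 'p::card2) laurent_tz"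
  assumes "CARD('p) = p" "prime p" "k \<le> m"
  shows "of_nat p ^ Suc (m - k) dvd f ^ (p ^ m) - frob (p ^ k) f ^ (p ^ (m - k))"
  using assms(3)
proof (induction k)
  case 0
  then show ?case by (simp add: frob_1[unfolded One_nat_def])
next
  case (Suc k)
  define n where "n = m - Suc k"
  have n: "m - k = Suc n" using Suc.prems by (simp add: n_def)
  have "of_nat (p ^ Suc n) dvd f ^ (p ^ Suc n) - frob p f ^ (p ^ n)"
    using dvd_iterated_power_diff[OF frob_congruence[OF assms(1,2)]] by simp
  then have "of_nat (p ^ Suc n) dvd frob (p ^ k) (f ^ (p ^ Suc n) - frob p f ^ (p ^ n))"
    by (intro dvd_additive_image[where F = "frob (p ^ k)"] frob_add)
  also have "frob (p ^ k) (f ^ (p ^ Suc n) - frob p f ^ (p ^ n)) =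
      frob (p ^ k) f ^ (p ^ Suc n) - frob (p ^ Suc k) f ^ (p ^ n)"
    by (simp only: frob_diff frob_power frob_frob power_Suc2)
  finally have "of_nat p ^ Suc n dvd frob (p ^ k) f ^ (p ^ Suc n) - frob (p ^ Suc k) f ^ (p ^ n)"
    by simp
  moreover have "of_nat p ^ Suc n dvd f ^ (p ^ m) - frob (p ^ k) f ^ (p ^ Suc n)"
    using Suc n by (auto intro: dvd_mult_right)
  ultimately have "of_nat p ^ Suc n dvd f ^ (p ^ m) - frob (p ^ Suc k) f ^ (p ^ n)"
    using dvd_add by fastforce
  then show ?case by (simp only: n_def)
qed

section \<open>Indecomposable parts of a twisted product\<close>

lemma frob_twisted_prod_drop:
  assumes "k \<le> length L"
  shows "frob (p ^ k) (twisted_prod p (drop k L)) =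
    (\<Prod>i\<in>{k..<length L}. frob (p ^ k) (L ! i) ^ (p ^ (i - k)))"
proof -
  have "frob (p ^ k) (twisted_prod p (drop k L)) =
      (\<Prod>i<length L - k. frob (p ^ k) (L ! (k + i)) ^ (p ^ i))"
    using assms by (simp add: twisted_prod_def frob_prod frob_power)
  also have "\<dots> = (\<Prod>i\<in>{k..<length L}. frob (p ^ k) (L ! i) ^ (p ^ (i - k)))"
    using assms by (intro prod.reindex_bij_witness[of _ "\<lambda>i. i - k" "\<lambda>i. k + i"]) auto
  finally show ?thesis .
qed

lemma frob_twisted_prod_drop_snoc:
  assumes "k \<le> length L"
  shows "frob (p ^ k) (twisted_prod p (drop k (L @ [x]))) =
    frob (p ^ k) (twisted_prod p (drop k L)) * frob (p ^ k) x ^ (p ^ (length L - k))"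
proof -
  have "{k..<length (L @ [x])} = insert (length L) {k..<length L}" using assms by auto
  then have "frob (p ^ k) (twisted_prod p (drop k (L @ [x]))) =
      frob (p ^ k) x ^ (p ^ (length L - k)) *
        (\<Prod>i\<in>{k..<length L}. frob (p ^ k) ((L @ [x]) ! i) ^ (p ^ (i - k)))"
    using assms by (subst frob_twisted_prod_drop) simp_all
  also have "(\<Prod>i\<in>{k..<length L}. frob (p ^ k) ((L @ [x]) ! i) ^ (p ^ (i - k))) =
      frob (p ^ k) (twisted_prod p (drop k L))"
    using assms by (simp add: frob_twisted_prod_drop nth_append)
  finally show ?thesis by (simp add: mult.commute)
qed

text \<open>The parts are defined so that the twisted product of a tuple becomes a sum over the ways to cut
  off an initial segment: the part of that segment times the Frobenius-twisted product of the rest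
  (lemma \<open>twisted_prod_decomposition\<close>). For one entry the part is the entry itself, and for two
  entries it is \<open>\<Lambda>\<^sub>0 (\<Lambda>\<^sub>1\<^sup>p - \<sigma> \<Lambda>\<^sub>1)\<close>. It measures how far the twisted product is from splitting
  at some place.\<close>

function indecomposable_part ::
  "nat \<Rightarrow> ('r::finite, 's::finite, 'p::card2) laurent_tz list \<Rightarrow> ('r, 's, 'p) laurent_tz" where
  "indecomposable_part p L = twisted_prod p L -
     (\<Sum>k\<in>{1..<length L}. indecomposable_part p (take k L) * frob (p ^ k) (twisted_prod p (drop k L)))"
  by pat_completeness auto
termination by (relation "Wellfounded.measure (\<lambda>(_, L). length L)") auto

declare indecomposable_part.simps [simp del]

lemma twisted_prod_decomposition:
  assumes "L \<noteq> []"
  shows "twisted_prod p L =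
    (\<Sum>k\<in>{1..length L}. indecomposable_part p (take k L) * frob (p ^ k) (twisted_prod p (drop k L)))"
proof -
  have "{1..length L} = insert (length L) {1..<length L}"
    using assms by (cases L) auto
  moreover have "frob (p ^ length L) (twisted_prod p (drop (length L) L)) = 1"
    by (subst frob_twisted_prod_drop) auto
  ultimately show ?thesis by (simp add: indecomposable_part.simps[of p L])
qed

text \<open>Let the tuple be \<open>M\<close> followed by one entry \<open>x\<close>, and put \<open>m = length M\<close>. Appending \<open>x\<close> multiplies the
  \<open>k\<close>-th twisted tail \<open>T\<^sub>k\<close> by \<open>y\<^sub>k\<close>, the \<open>p\<^sup>m\<^sup>-\<^sup>k\<close>-th power of \<open>\<sigma>\<^sup>k x\<close>. Expanding \<open>T\<^sub>0\<close> by the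
  decomposition for \<open>M\<close> turns the definition of the new part into \<open>\<Sum> I\<^sub>k T\<^sub>k (y\<^sub>0 - y\<^sub>k)\<close>, where \<open>I\<^sub>k\<close> is
  the part of the first \<open>k\<close> entries. There \<open>I\<^sub>k\<close> is divisible by \<open>p\<^sup>k\<^sup>-\<^sup>1\<close> by induction, and
  \<open>y\<^sub>0 - y\<^sub>k\<close> by \<open>p\<^sup>m\<^sup>-\<^sup>k\<^sup>+\<^sup>1\<close>.\<close>

lemma dvd_indecomposable_part:
  fixes L :: "('r::finite, 's::finite, 'p::card2) laurent_tz list"
  assumes p: "CARD('p) = p" "prime p"
  shows "of_nat p ^ (length L - 1) dvd indecomposable_part p L"
proof (induction L rule: length_induct)
  case (1 L)
  show ?case
  proof (cases "length L \<le> 1")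
    case False
    then obtain M x where L: "L = M @ [x]" and M: "M \<noteq> []"
      by (cases L rule: rev_cases) auto
    define T where "T k = frob (p ^ k) (twisted_prod p (drop k M))" for k
    define y where "y k = frob (p ^ k) x ^ (p ^ (length M - k))" for k
    have TL: "frob (p ^ k) (twisted_prod p (drop k L)) = T k * y k" if "k \<le> length M" for k
      unfolding L T_def y_def by (rule frob_twisted_prod_drop_snoc[OF that])
    have T0: "T 0 = twisted_prod p M"
      by (simp add: T_def frob_1[unfolded One_nat_def])
    have "twisted_prod p L = T 0 * y 0"
      using TL[of 0] by (simp add: frob_1[unfolded One_nat_def])
    also have "T 0 = (\<Sum>k\<in>{1..length M}. indecomposable_part p (take k M) * T k)"
      unfolding T0 unfolding T_def by (rule twisted_prod_decomposition[OF M])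
    finally have tp: "twisted_prod p L =
      (\<Sum>k\<in>{1..length M}. indecomposable_part p (take k M) * T k) * y 0" .
    have cuts: "(\<Sum>k\<in>{1..<length L}. indecomposable_part p (take k L) * frob (p ^ k) (twisted_prod p (drop k L))) =
        (\<Sum>k\<in>{1..length M}. indecomposable_part p (take k M) * (T k * y k))"
    proof (rule sum.cong)
      fix k assume k: "k \<in> {1..length M}"
      then have "take k L = take k M" by (simp add: L)
      then show "indecomposable_part p (take k L) * frob (p ^ k) (twisted_prod p (drop k L)) =
          indecomposable_part p (take k M) * (T k * y k)"
        using k TL[of k] by simp
    qed (auto simp: L)
    have ip: "indecomposable_part p L =
        (\<Sum>k\<in>{1..length M}. indecomposable_part p (take k M) * (y 0 - y k) * T k)"
      unfolding indecomposable_part.simps[of p L] tp cuts sum_distrib_right sum_subtractf[symmetric]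
      by (intro sum.cong) (simp_all add: algebra_simps)
    show ?thesis
      unfolding ip
    proof (rule dvd_sum, rule dvd_mult2)
      fix k assume k: "k \<in> {1..length M}"
      have "of_nat p ^ (k - 1) dvd indecomposable_part p (take k M)"
        using 1[rule_format, of "take k M"] k by (simp add: L)
      moreover have "of_nat p ^ Suc (length M - k) dvd y 0 - y k"
        using frob_power_congruence[OF p, of k "length M" x] k
        by (simp add: y_def frob_1[unfolded One_nat_def])
      ultimately have "of_nat p ^ (k - 1) * of_nat p ^ Suc (length M - k)
          dvd indecomposable_part p (take k M) * (y 0 - y k)"
        by (rule mult_dvd_mono)
      moreover have "k - 1 + Suc (length M - k) = length L - 1"
        using k by (auto simp: L)
      ultimately show "of_nat p ^ (length L - 1) dvd indecomposable_part p (take k M) * (y 0 - y k)"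
        by (simp only: power_add[symmetric])
    qed
  qed simp
qed

section \<open>Exponents and Newton polytopes\<close>

definition t_exponents :: "('r::finite, 's::finite, 'p::card2) laurent_tz \<Rightarrow> (real ^ 'r) set" where
  "t_exponents f = real_vec ` fst ` Poly_Mapping.keys f"

lemma t_exponents_subset_newton_polytope: "t_exponents f \<subseteq> newton_polytope f"
  by (simp add: t_exponents_def newton_polytope_def hull_subset)

lemma t_exponents_mult: "t_exponents (f * g) \<subseteq> t_exponents f + t_exponents g"
proof
  fix w assume "w \<in> t_exponents (f * g)"
  then obtain a b where "a \<in> Poly_Mapping.keys f" "b \<in> Poly_Mapping.keys g" "w = real_vec (fst (a + b))"
    using keys_mult[of f g] by (auto simp: t_exponents_def)
  moreover have "real_vec (fst (a + b)) = real_vec (fst a) + real_vec (fst b)"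
    by (simp add: real_vec_def vec_eq_iff)
  ultimately show "w \<in> t_exponents f + t_exponents g"
    by (auto simp: t_exponents_def intro!: set_plus_intro)
qed

lemma t_exponents_one: "t_exponents 1 = {0}"
  by (simp add: t_exponents_def real_vec_def vec_eq_iff)

lemma t_exponents_diff: "t_exponents (f - g) \<subseteq> t_exponents f \<union> t_exponents g"
  unfolding t_exponents_def image_Un[symmetric] by (intro image_mono keys_diff)

lemma t_exponents_sum: "t_exponents (\<Sum>i\<in>A. f i) \<subseteq> (\<Union>i\<in>A. t_exponents (f i))"
  unfolding t_exponents_def image_UN[symmetric] by (intro image_mono keys_sum)

lemma t_exponents_prod:
  assumes "finite A" "\<And>i. i \<in> A \<Longrightarrow> t_exponents (f i) \<subseteq> S i"
  shows "t_exponents (\<Prod>i\<in>A. f i) \<subseteq> (\<Sum>i\<in>A. S i)"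
  using assms
proof (induction A)
  case (insert i A)
  then have "t_exponents (f i) + t_exponents (prod f A) \<subseteq> S i + sum S A"
    by (intro set_plus_mono2) auto
  then show ?case using insert t_exponents_mult[of "f i" "prod f A"] by auto
qed (simp add: t_exponents_one set_zero)

lemma t_exponents_frob: "t_exponents (frob n f) \<subseteq> (*\<^sub>R) (real n) ` t_exponents f"
proof
  fix w assume "w \<in> t_exponents (frob n f)"
  then obtain k where k: "k \<in> Poly_Mapping.keys f" "w = real_vec (scale_exponent n (fst k))"
    using keys_sum[of "\<lambda>k. Poly_Mapping.single (map_prod (scale_exponent n) (scale_exponent n) k)
      (Poly_Mapping.lookup f k)" "Poly_Mapping.keys f"]
    by (auto simp: t_exponents_def frob_def map_exponents_def split: if_splits)
  moreover have "real_vec (scale_exponent n (fst k)) = real n *\<^sub>R real_vec (fst k)"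
    by (simp add: real_vec_def vec_eq_iff)
  ultimately show "w \<in> (*\<^sub>R) (real n) ` t_exponents f"
    by (auto simp: t_exponents_def)
qed

text \<open>Convexity gives \<open>S + n S \<subseteq> (n + 1) S\<close>; this is why polytopes are needed and not just
  finite sets of exponents.\<close>

lemma t_exponents_power:
  assumes "n > 0" "convex S" "t_exponents f \<subseteq> S"
  shows "t_exponents (f ^ n) \<subseteq> (*\<^sub>R) (real n) ` S"
  using assms(1)
proof (induction n rule: nat_induct_non_zero)
  case 1
  then show ?case using assms(3) by auto
next
  case (Suc n)
  have "t_exponents (f ^ Suc n) \<subseteq> S + (*\<^sub>R) (real n) ` S"
    using t_exponents_mult[of f "f ^ n"] set_plus_mono2[OF assms(3) Suc.IH] by auto
  also have "\<dots> \<subseteq> (*\<^sub>R) (real (Suc n)) ` S"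
  proof
    fix w assume "w \<in> S + (*\<^sub>R) (real n) ` S"
    then obtain x y where xy: "x \<in> S" "y \<in> S" "w = x + real n *\<^sub>R y"
      by (auto elim!: set_plus_elim)
    have "(1 / real (Suc n)) *\<^sub>R x + (real n / real (Suc n)) *\<^sub>R y \<in> S"
      using xy by (intro convexD[OF assms(2)]) (simp_all add: field_simps)
    moreover have "w = real (Suc n) *\<^sub>R ((1 / real (Suc n)) *\<^sub>R x + (real n / real (Suc n)) *\<^sub>R y)"
      using xy by (simp add: scaleR_add_right del: of_nat_Suc)
    ultimately show "w \<in> (*\<^sub>R) (real (Suc n)) ` S" by blast
  qed
  finally show ?case .
qed

text \<open>The Minkowski sum of \<open>p\<^sup>i N\<^sub>i\<close> over \<open>m \<le> i < n\<close>. The weights are those of the whole tuple, so that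
  the sums over \<open>[0, k)\<close> and \<open>[k, l)\<close> add up to the sum over \<open>[0, l)\<close>.\<close>

definition weighted_newton ::
  "nat \<Rightarrow> ('r::finite, 's::finite, 'p::card2) laurent_tz list \<Rightarrow> nat \<Rightarrow> nat \<Rightarrow> (real ^ 'r) set" where
  "weighted_newton p L m n = (\<Sum>i\<in>{m..<n}. (*\<^sub>R) (real (p ^ i)) ` newton_polytope (L ! i))"

lemma t_exponents_twisted_prod_drop:
  fixes L :: "('r::finite, 's::finite, 'p::card2) laurent_tz list"
  assumes "p > 0" "k \<le> length L"
  shows "t_exponents (frob (p ^ k) (twisted_prod p (drop k L))) \<subseteq> weighted_newton p L k (length L)"
  unfolding frob_twisted_prod_drop[OF assms(2)] weighted_newton_def
proof (rule t_exponents_prod)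
  fix i assume i: "i \<in> {k..<length L}"
  let ?N = "newton_polytope (L ! i)"
  have "t_exponents (frob (p ^ k) (L ! i)) \<subseteq> (*\<^sub>R) (real (p ^ k)) ` ?N"
    using t_exponents_frob t_exponents_subset_newton_polytope by blast
  then have "t_exponents (frob (p ^ k) (L ! i) ^ (p ^ (i - k)))
      \<subseteq> (*\<^sub>R) (real (p ^ (i - k))) ` (*\<^sub>R) (real (p ^ k)) ` ?N"
    using assms(1) by (intro t_exponents_power convex_scaling)
      (simp_all add: newton_polytope_def convex_convex_hull)
  also have "\<dots> = (*\<^sub>R) (real (p ^ i)) ` ?N"
    using i by (simp add: image_image power_add[symmetric])
  finally show "t_exponents (frob (p ^ k) (L ! i) ^ (p ^ (i - k))) \<subseteq> (*\<^sub>R) (real (p ^ i)) ` ?N" .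
qed simp

lemma t_exponents_indecomposable_part:
  assumes "p > 0"
  shows "t_exponents (indecomposable_part p L) \<subseteq> weighted_newton p L 0 (length L)"
proof (induction L rule: length_induct)
  case (1 L)
  let ?W = "weighted_newton p L"
  have "t_exponents (twisted_prod p L) \<subseteq> ?W 0 (length L)"
    using t_exponents_twisted_prod_drop[OF assms, of 0 L] by (simp add: frob_1[unfolded One_nat_def])
  moreover have "t_exponents (indecomposable_part p (take k L) * frob (p ^ k) (twisted_prod p (drop k L)))
      \<subseteq> ?W 0 (length L)" if k: "k \<in> {1..<length L}" for k
  proof -
    have "t_exponents (indecomposable_part p (take k L)) \<subseteq> weighted_newton p (take k L) 0 k"
      using 1[rule_format, of "take k L"] k by simp
    also have "\<dots> = ?W 0 k"
      using k by (simp add: weighted_newton_def)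
    finally have "t_exponents (indecomposable_part p (take k L)) +
        t_exponents (frob (p ^ k) (twisted_prod p (drop k L))) \<subseteq> ?W 0 k + ?W k (length L)"
      using t_exponents_twisted_prod_drop[OF assms, of k L] k by (intro set_plus_mono2) simp_all
    also have "\<dots> = ?W 0 (length L)"
      using k by (simp add: weighted_newton_def sum.atLeastLessThan_concat)
    finally show ?thesis using t_exponents_mult by blast
  qed
  ultimately show ?case
    unfolding indecomposable_part.simps[of p L]
    using t_exponents_diff t_exponents_sum by (blast dest!: subsetD[OF t_exponents_diff] subsetD[OF t_exponents_sum])
qed

section \<open>Constant terms of admissible tuples\<close>

lemma admissible_drop:
  assumes "admissible p L"
  shows "admissible p (drop n L)"
  unfolding admissible_def admissible_polytopes_def
proof (intro allI impI)
  fix i j assume ij: "i \<le> j \<and> j < length (map newton_polytope (drop n L))"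
  let ?N = "map newton_polytope L"
  have "(\<Sum>k=i..j. (\<lambda>x. real p ^ (k - i) *\<^sub>R x) ` (map newton_polytope (drop n L) ! k)) =
      (\<Sum>k=n+i..n+j. (\<lambda>x. real p ^ (k - (n + i)) *\<^sub>R x) ` (?N ! k))"
    using ij by (intro sum.reindex_bij_witness[of _ "\<lambda>k. k - n" "\<lambda>k. n + k"])
      (auto simp: add.commute[of _ n])
  moreover have "(\<Sum>k=n+i..n+j. (\<lambda>x. real p ^ (k - (n + i)) *\<^sub>R x) ` (?N ! k)) \<inter>
      range (\<lambda>u. real p ^ (n + j - (n + i) + 1) *\<^sub>R real_vec u) = {0}"
    by (rule assms[unfolded admissible_def admissible_polytopes_def, rule_format]) (use ij in auto)
  ultimately show "(\<Sum>k=i..j. (\<lambda>x. real p ^ (k - i) *\<^sub>R x) ` (map newton_polytope (drop n L) ! k)) \<inter>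
      range (\<lambda>u. real p ^ (j - i + 1) *\<^sub>R real_vec u) = {0}"
    by simp
qed

lemma admissible_weighted_newton:
  assumes "admissible p L" "1 \<le> k" "k \<le> length L"
  shows "weighted_newton p L 0 k \<inter> range (\<lambda>u. real p ^ k *\<^sub>R real_vec u) = {0}"
proof -
  have "(\<Sum>i=0..k-1. (\<lambda>x. real p ^ (i - 0) *\<^sub>R x) ` (map newton_polytope L ! i)) =
      weighted_newton p L 0 k"
    unfolding weighted_newton_def using assms by (intro sum.cong) auto
  then show ?thesis
    using assms(1)[unfolded admissible_def admissible_polytopes_def, rule_format, of 0 "k - 1"] assms
    by (simp add: Suc_diff_le)
qed

text \<open>A monomial of the product that is constant in \<open>t\<close> combines an exponent \<open>u\<close> of the indecomposable
  part with one in \<open>p\<^sup>k \<int>\<^sup>r\<close>, so \<open>u\<close> itself lies in \<open>p\<^sup>k \<int>\<^sup>r\<close>. It also lies in the weighted Newton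
  polytope of the first \<open>k\<close> entries, and admissibility leaves only \<open>u = 0\<close>.\<close>

lemma CT_indecomposable_part_mult_frob:
  assumes "p > 0" "admissible p L" "1 \<le> k" "k \<le> length L"
  shows "CT (indecomposable_part p (take k L) * frob (p ^ k) g) =
    CT (indecomposable_part p (take k L)) * subst_power (p ^ k) (CT g)"
  unfolding frob_def subst_power_eq_map_exponents
proof (rule CT_mult_map_exponents)
  fix x y
  assume x: "x \<in> Poly_Mapping.keys (indecomposable_part p (take k L))"
    and xy: "fst x + scale_exponent (p ^ k) y = 0"
  have "real_vec (fst x) \<in> weighted_newton p (take k L) 0 (length (take k L))"
    using t_exponents_indecomposable_part[OF assms(1), of "take k L"] x by (auto simp: t_exponents_def)
  then have "real_vec (fst x) \<in> weighted_newton p L 0 k"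
    using assms by (simp add: weighted_newton_def)
  moreover have "fst x = scale_exponent (p ^ k) (- y)"
    using xy by (simp add: vec_eq_iff eq_neg_iff_add_eq_0)
  then have "real_vec (fst x) = real p ^ k *\<^sub>R real_vec (- y)"
    by (simp add: real_vec_def vec_eq_iff)
  ultimately have "real_vec (fst x) = 0"
    using admissible_weighted_newton[OF assms(2-4)] by blast
  then have "fst x = 0" by (simp add: real_vec_def vec_eq_iff)
  moreover have "y = 0"
    using xy assms(1) by (simp add: \<open>fst x = 0\<close> vec_eq_iff)
  ultimately show "fst x = 0 \<and> y = 0" ..
qed simp

lemma CT_twisted_prod_decomposition:
  assumes "p > 0" "admissible p L" "L \<noteq> []"
  shows "CT (twisted_prod p L) = (\<Sum>k\<in>{1..length L}.
    CT (indecomposable_part p (take k L)) * subst_power (p ^ k) (CT (twisted_prod p (drop k L))))"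
  using assms
  by (subst twisted_prod_decomposition) (simp_all add: CT_sum CT_indecomposable_part_mult_frob)

lemma dvd_CT_indecomposable_part:
  fixes L :: "('r::finite, 's::finite, 'p::card2) laurent_tz list"
  assumes "CARD('p) = p" "prime p"
  shows "of_nat (p ^ (length L - 1)) dvd CT (indecomposable_part p L)"
  using dvd_indecomposable_part[OF assms, of L]
  by (intro dvd_additive_image[where F = CT] CT_add) simp

section \<open>Determinants of solutions of a triangular system\<close>

text \<open>Two sequences that solve the same triangular system up to small errors have small minors.
  Expanding the row \<open>i\<close> reduces the minor \<open>(i, j)\<close> to the minors \<open>(k, j)\<close> with \<open>k > i\<close>, both of whose
  indices exceed \<open>i\<close>. For \<open>k < j\<close> such a minor already has the required divisibility, for \<open>k = j\<close> it
  vanishes, and for \<open>k > j\<close> its deficit \<open>k - j\<close> is made up by the coefficient, which is divisible by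
  \<open>q\<^sup>k\<^sup>-\<^sup>i\<^sup>-\<^sup>1\<close>.\<close>

lemma dvd_triangular_determinant:
  fixes X Y E F :: "nat \<Rightarrow> 'a::comm_ring_1"
  assumes X: "\<And>i. i < n \<Longrightarrow> X i = (\<Sum>k\<in>{i<..n}. J i k * X k) + E i"
    and Y: "\<And>i. i < n \<Longrightarrow> Y i = (\<Sum>k\<in>{i<..n}. J i k * Y k) + F i"
    and J: "\<And>i k. i < k \<Longrightarrow> k \<le> n \<Longrightarrow> q ^ (k - i - 1) dvd J i k"
    and E: "\<And>i. i < n \<Longrightarrow> q ^ (n - i) dvd E i"
    and F: "\<And>i. i < n \<Longrightarrow> q ^ (n - i) dvd F i"
    and "i < j" "j \<le> n"
  shows "q ^ (n - j + 1) dvd X i * Y j - X j * Y i"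
  using \<open>i < j\<close> \<open>j \<le> n\<close>
proof (induction "n - i" arbitrary: i j rule: less_induct)
  case less
  define D where "D k l = X k * Y l - X l * Y k" for k l
  have i: "i < n" using less.prems by simp
  have "D i j = (\<Sum>k\<in>{i<..n}. J i k * D k j) + (E i * Y j - F i * X j)"
    unfolding D_def X[OF i] Y[OF i]
    by (simp add: sum_distrib_left sum_distrib_right sum_subtractf algebra_simps)
  moreover have "q ^ (n - j + 1) dvd E i * Y j - F i * X j"
  proof -
    have "q ^ (n - j + 1) dvd q ^ (n - i)" using less.prems by (intro le_imp_power_dvd) auto
    then show ?thesis using E[OF i] F[OF i] by (meson dvd_diff dvd_mult2 dvd_trans)
  qed
  moreover have "q ^ (n - j + 1) dvd J i k * D k j" if k: "k \<in> {i<..n}" for k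
  proof (cases k j rule: linorder_cases)
    case less
    then show ?thesis
      using less.hyps[of k j] k less.prems by (simp add: D_def)
  next
    case equal
    then show ?thesis by (simp add: D_def)
  next
    case greater
    have "q ^ (n - k + 1) dvd D j k"
      unfolding D_def using greater k \<open>i < j\<close> \<open>j \<le> n\<close> by (intro less.hyps) auto
    moreover have "D k j = - D j k" by (simp add: D_def)
    ultimately have "q ^ (k - i - 1) * q ^ (n - k + 1) dvd J i k * D k j"
      using J[of i k] k by (intro mult_dvd_mono) simp_all
    moreover have "q ^ (n - j + 1) dvd q ^ (k - i - 1) * q ^ (n - k + 1)"
      unfolding power_add[symmetric] using k less.prems by (intro le_imp_power_dvd) auto
    ultimately show ?thesis by (rule dvd_trans[rotated])
  qed
  ultimately have "q ^ (n - j + 1) dvd D i j"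
    by (metis (no_types, lifting) dvd_add dvd_sum)
  then show ?case by (simp add: D_def)
qed

section \<open>The congruence\<close>

text \<open>Cuts inside \<open>a\<close> give coefficients that involve only \<open>a\<close>. The cuts beyond \<open>a\<close> are collected in the
  error term \<open>E\<close>: their indecomposable parts have more than \<open>length a - i\<close> entries
  and are therefore divisible by \<open>p\<close> to that power.\<close>

lemma CT_twisted_prod_triangular_system:
  fixes a b :: "('r::finite, 's::finite, 'p::card2) laurent_tz list"
  assumes p: "CARD('p) = p" "prime p" and adm: "admissible p (a @ b)" and i: "i < length a"
  defines "X \<equiv> \<lambda>k. subst_power (p ^ k) (CT (twisted_prod p (drop k (a @ b))))"
  obtains E where "of_nat p ^ (length a - i) dvd E"
    and "X i = (\<Sum>k\<in>{i<..length a}.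
      subst_power (p ^ i) (CT (indecomposable_part p (take (k - i) (drop i a)))) * X k) + E"
proof -
  define L where "L = drop i (a @ b)"
  define J where "J k = subst_power (p ^ i) (CT (indecomposable_part p (take (k - i) L)))" for k
  have p0: "p > 0" using p(2) prime_gt_0_nat by blast
  have len: "length L = length (a @ b) - i" by (simp add: L_def)
  have "L \<noteq> []" using i by (simp add: L_def)
  have dr: "drop k L = drop (i + k) (a @ b)" for k
    by (simp add: L_def add.commute del: drop_append)
  have "X i = (\<Sum>k\<in>{1..length L}. subst_power (p ^ i) (CT (indecomposable_part p (take k L))) * X (i + k))"
    unfolding X_def L_def[symmetric]
    using CT_twisted_prod_decomposition[OF p0 admissible_drop[OF adm, of i, folded L_def] \<open>L \<noteq> []\<close>]
    by (simp add: subst_power_sum subst_power_mult subst_power_subst_power power_add dr[symmetric] del: drop_append)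
  also have "\<dots> = (\<Sum>k\<in>{i<..length (a @ b)}. J k * X k)"
    unfolding len J_def
    by (intro sum.reindex_bij_witness[of _ "\<lambda>k. k - i" "\<lambda>k. i + k"]) auto
  also have "{i<..length (a @ b)} = {i<..length a} \<union> {length a<..length (a @ b)}"
    using i by auto
  also have "(\<Sum>k\<in>\<dots>. J k * X k) = (\<Sum>k\<in>{i<..length a}. J k * X k) +
      (\<Sum>k\<in>{length a<..length (a @ b)}. J k * X k)"
    by (intro sum.union_disjoint) auto
  also have "(\<Sum>k\<in>{i<..length a}. J k * X k) = (\<Sum>k\<in>{i<..length a}.
      subst_power (p ^ i) (CT (indecomposable_part p (take (k - i) (drop i a)))) * X k)"
    by (intro sum.cong) (auto simp: J_def L_def)
  finally have "X i = (\<Sum>k\<in>{i<..length a}.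
      subst_power (p ^ i) (CT (indecomposable_part p (take (k - i) (drop i a)))) * X k) +
      (\<Sum>k\<in>{length a<..length (a @ b)}. J k * X k)" .
  moreover have "of_nat p ^ (length a - i) dvd (\<Sum>k\<in>{length a<..length (a @ b)}. J k * X k)"
  proof (intro dvd_sum dvd_mult2)
    fix k assume k: "k \<in> {length a<..length (a @ b)}"
    have "of_nat (p ^ (length (take (k - i) L) - 1)) dvd J k"
      unfolding J_def
      by (intro dvd_additive_image[where F = "subst_power (p ^ i)"] subst_power_add
          dvd_CT_indecomposable_part p)
    moreover have "length (take (k - i) L) - 1 = k - i - 1" using k by (auto simp: len min_def)
    ultimately have "of_nat p ^ (k - i - 1) dvd J k" by simp
    moreover have "(of_nat p :: ('s, 'p) laurent_z) ^ (length a - i) dvd of_nat p ^ (k - i - 1)"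
      using k by (intro le_imp_power_dvd) auto
    ultimately show "of_nat p ^ (length a - i) dvd J k" by (rule dvd_trans[rotated])
  qed
  ultimately show ?thesis by (intro that)
qed

theorem theorem2p9:
  fixes p :: nat
    and a b c :: "('r::finite, 's::finite, 'p::card2) laurent_tz list"
  assumes "CARD('p) = p" and "prime p" and "odd p"
    and "length a \<ge> 1"
    and "admissible p (a @ b)"
    and "admissible p (a @ c)"
    and "admissible p (tl a @ b)"
    and "admissible p (tl a @ c)"
  shows "of_nat (p ^ length a) dvd
           (CT (twisted_prod p (a @ b)) * subst_power p (CT (twisted_prod p (tl a @ c)))
            - subst_power p (CT (twisted_prod p (tl a @ b))) * CT (twisted_prod p (a @ c)))"
proof -
  define X where "X d k = subst_power (p ^ k) (CT (twisted_prod p (drop k (a @ d))))" for d k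
  define J where "J i k = subst_power (p ^ i) (CT (indecomposable_part p (take (k - i) (drop i a))))" for i k
  have sys: "\<exists>E. \<forall>i<length a. of_nat p ^ (length a - i) dvd E i \<and>
      X d i = (\<Sum>k\<in>{i<..length a}. J i k * X d k) + E i" if "admissible p (a @ d)" for d
  proof -
    have "\<exists>e. i < length a \<longrightarrow> of_nat p ^ (length a - i) dvd e \<and>
        X d i = (\<Sum>k\<in>{i<..length a}. J i k * X d k) + e" for i
    proof (cases "i < length a")
      case True
      show ?thesis
        unfolding X_def J_def
        by (rule CT_twisted_prod_triangular_system[OF assms(1,2) that True]) blast
    qed simp
    then have "\<forall>i. \<exists>e. i < length a \<longrightarrow> of_nat p ^ (length a - i) dvd e \<and>
        X d i = (\<Sum>k\<in>{i<..length a}. J i k * X d k) + e" by blast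
    from choice[OF this] show ?thesis .
  qed
  obtain E where E: "\<And>i. i < length a \<Longrightarrow> of_nat p ^ (length a - i) dvd E i"
      "\<And>i. i < length a \<Longrightarrow> X b i = (\<Sum>k\<in>{i<..length a}. J i k * X b k) + E i"
    using sys[OF assms(5)] by blast
  obtain F where F: "\<And>i. i < length a \<Longrightarrow> of_nat p ^ (length a - i) dvd F i"
      "\<And>i. i < length a \<Longrightarrow> X c i = (\<Sum>k\<in>{i<..length a}. J i k * X c k) + F i"
    using sys[OF assms(6)] by blast
  have J: "of_nat p ^ (k - i - 1) dvd J i k" if "i < k" "k \<le> length a" for i k
  proof -
    have "of_nat (p ^ (length (take (k - i) (drop i a)) - 1)) dvd J i k"
      unfolding J_def
      by (intro dvd_additive_image[where F = "subst_power (p ^ i)"] subst_power_add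
          dvd_CT_indecomposable_part assms(1,2))
    moreover have "length (take (k - i) (drop i a)) - 1 = k - i - 1" using that by (auto simp: min_def)
    ultimately show ?thesis by simp
  qed
  have "of_nat p ^ (length a - 1 + 1) dvd X b 0 * X c 1 - X b 1 * X c 0"
    by (rule dvd_triangular_determinant[OF E(2) F(2) J E(1) F(1)]) (use assms(4) in auto)
  moreover have "X d 0 = CT (twisted_prod p (a @ d))" for d
    by (simp add: X_def subst_power_1[unfolded One_nat_def])
  moreover have "X d 1 = subst_power p (CT (twisted_prod p (tl a @ d)))" for d
    using assms(4) by (cases a) (simp_all add: X_def)
  moreover have "length a - 1 + 1 = length a" using assms(4) by simp
  ultimately show ?thesis by (simp only: of_nat_power)
qed

end
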